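(* Let $(X,\tau)$ be a topological space. Then the Morse hyper-graph $\mathcal{G}_\tau=(V,H)$ of $\tau$ is a quotient space of the abstract element space $X/\langle\tau\rangle$. That is, every abstract element $\langle x\rangle$ ($x\in X$) is contained in a single member of the decomposition of $X$ consisting of the vertices $X_\lambda$ ($\lambda\in\Lambda$) and the non-empty hyper-edges $H_I$ ($I\subseteq\Lambda$), so that the quotient of $X$ by this decomposition is a quotient space of $X/\langle\tau\rangle$.
   Context: Let $(X,\tau)$ be a topological space. The class of $x\in X$ is $\hat{x}=\{y\in X\mid \overline{\{x\}}=\overline{\{y\}}\}$; a subset of $X$ is invariant if it is a union of classes. A point $x$ is closed if $\{x\}$ is closed, and proper (or $T_D$) if $\overline{\{x\}}\setminus\{x\}$ is closed. $\mathrm{Cl}(\tau)$, $\mathrm{P}(\tau)$, $\mathrm{R}(\tau)$ denote the sets of closed points, of non-closed proper points, and of non-proper points. The set of recurrent points is $\mathcal{R}(\tau)=\mathrm{Cl}(\tau)\sqcup\mathrm{R}(\tau)$. The abstract element $\langle x\rangle$ of $x\in X$ is: for $x\in\mathrm{Cl}(\tau)\sqcup\mathrm{P}(\tau)$, the connected component containing $x$ of $\{x'\in X\mid \overline{\{x\}}\setminus\{x\}=\overline{\{x'\}}\setminus\{x'\}\}$; for $x\in\mathrm{R}(\tau)$, the connected component containing $x$ of $\{x'\in X\mid\overline{\{x\}}=\overline{\{x'\}}\}$. The abstract elements form a decomposition of $X$, and the abstract element space $X/\langle\tau\rangle$ is the quotient space of $X$ identifying $x$ and $y$ when $\langle x\rangle=\langle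 y\rangle$. A point $x$ is non-maximal if there is $y\in X$ with $\overline{\{x\}}\subsetneq\overline{\{y\}}$. A point $x$ is quasi-recurrent if $\langle x\rangle$ contains a recurrent or a non-maximal point; $\mathcal{Q}(\tau)$ is the set of quasi-recurrent points. Let $\mathcal{X}=\{X_\lambda\}_{\lambda\in\Lambda}$ be the set of connected components of $\mathcal{Q}(\tau)$ (these are pairwise disjoint invariant non-empty sets). For $I\subseteq\Lambda$, the hyper-edge $H_I$ is the set of points $x\in X\setminus\bigsqcup_{\lambda\in\Lambda}X_\lambda$ for which there are disjoint invariant non-empty subsets $(C_i)_{i\in I}$ of $\overline{\{x\}}\setminus\{x\}$ with $C_i\subseteq X_i$ and $\overline{\{x\}}\setminus\{x\}=\bigsqcup_{i\in I}C_i$. Put $V=\{X_\lambda\mid\lambda\in\Lambda\}$ and $H=\{\{X_i\}_{i\in I}\mid H_I\neq\emptyset,\ I\subseteq\Lambda\}$. The Morse hyper-graph of $\tau$ is $\mathcal{G}_\tau=(V,H)$; it is known to exist, i.e. $X\setminus\bigsqcup_{\lambda}X_\lambda=\bigsqcup_{I\subseteq\Lambda}H_I$. As a space it is regarded as the quotient of $X$ whose points are the sets $X_\lambda$ and the non-empty sets $H_I$. *)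

theory Defs
  imports "HOL-Analysis.Analysis"
begin

definition point_class :: "'a topology \<Rightarrow> 'a \<Rightarrow> 'a set" where
  "point_class X x = {y \<in> topspace X. X closure_of {x} = X closure_of {y}}"

definition invariant_set :: "'a topology \<Rightarrow> 'a set \<Rightarrow> bool" where
  "invariant_set X S \<longleftrightarrow> (\<exists>A \<subseteq> topspace X. S = (\<Union>x\<in>A. point_class X x))"

definition closed_points :: "'a topology \<Rightarrow> 'a set" where
  "closed_points X = {x \<in> topspace X. closedin X {x}}"

definition proper_points :: "'a topology \<Rightarrow> 'a set" where
  "proper_points X = {x \<in> topspace X. closedin X (X closure_of {x} - {x})}"

definition nonclosed_proper_points :: "'a topology \<Rightarrow> 'a set" where
  "nonclosed_proper_points X = proper_points X - closed_points X"

definition nonproper_points :: "'a topology \<Rightarrow> 'a set" where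
  "nonproper_points X = topspace X - proper_points X"

definition recurrent_points :: "'a topology \<Rightarrow> 'a set" where
  "recurrent_points X = closed_points X \<union> nonproper_points X"

definition abstract_element :: "'a topology \<Rightarrow> 'a \<Rightarrow> 'a set" where
  "abstract_element X x =
    (if x \<in> closed_points X \<union> nonclosed_proper_points X
     then connected_component_of_set
            (subtopology X {x' \<in> topspace X. X closure_of {x} - {x} = X closure_of {x'} - {x'}}) x
     else connected_component_of_set
            (subtopology X {x' \<in> topspace X. X closure_of {x} = X closure_of {x'}}) x)"

definition non_maximal_points :: "'a topology \<Rightarrow> 'a set" where
  "non_maximal_points X =
    {x \<in> topspace X. \<exists>y \<in> topspace X. X closure_of {x} \<subset> X closure_of {y}}"

definition quasi_recurrent_points :: "'a topology \<Rightarrow> 'a set" where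
  "quasi_recurrent_points X =
    {x \<in> topspace X. abstract_element X x \<inter> (recurrent_points X \<union> non_maximal_points X) \<noteq> {}}"

definition morse_vertices :: "'a topology \<Rightarrow> 'a set set" where
  "morse_vertices X = connected_components_of (subtopology X (quasi_recurrent_points X))"

(* The family of components is indexed by itself: an index set I is a set of vertices,
   and the component with index i is i. *)
definition hyper_edge :: "'a topology \<Rightarrow> 'a set set \<Rightarrow> 'a set" where
  "hyper_edge X I =
    {x \<in> topspace X - \<Union>(morse_vertices X).
       \<exists>C. (\<forall>i\<in>I. invariant_set X (C i) \<and> C i \<noteq> {} \<and> C i \<subseteq> X closure_of {x} - {x} \<and> C i \<subseteq> i) \<and>
           disjoint_family_on C I \<and>
           X closure_of {x} - {x} = (\<Union>i\<in>I. C i)}"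

definition morse_hyper_edges :: "'a topology \<Rightarrow> 'a set set set" where
  "morse_hyper_edges X = {I. I \<subseteq> morse_vertices X \<and> hyper_edge X I \<noteq> {}}"

definition morse_hypergraph :: "'a topology \<Rightarrow> 'a set set \<times> 'a set set set" where
  "morse_hypergraph X = (morse_vertices X, morse_hyper_edges X)"

definition morse_decomposition :: "'a topology \<Rightarrow> 'a set set" where
  "morse_decomposition X =
    (let (V, H) = morse_hypergraph X in V \<union> hyper_edge X ` H)"

(* Well defined on topspace X by partition_on_morse_decomposition below. *)
definition morse_cell :: "'a topology \<Rightarrow> 'a \<Rightarrow> 'a set" where
  "morse_cell X x = (THE D. D \<in> morse_decomposition X \<and> x \<in> D)"

(* The quotient of X identifying the points with equal image under p, with carrier p ` topspace X. *)
definition quotient_topology :: "'a topology \<Rightarrow> ('a \<Rightarrow> 'b) \<Rightarrow> 'b topology" where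
  "quotient_topology X p =
    topology (\<lambda>U. U \<subseteq> p ` topspace X \<and> openin X {x \<in> topspace X. p x \<in> U})"

definition abstract_element_space :: "'a topology \<Rightarrow> 'a set topology" where
  "abstract_element_space X = quotient_topology X (abstract_element X)"

definition morse_hypergraph_space :: "'a topology \<Rightarrow> 'a set topology" where
  "morse_hypergraph_space X = quotient_topology X (morse_cell X)"

lemma openin_quotient_topology:
  "openin (quotient_topology X p) U \<longleftrightarrow>
     U \<subseteq> p ` topspace X \<and> openin X {x \<in> topspace X. p x \<in> U}"
proof -
  have "istopology (\<lambda>U. U \<subseteq> p ` topspace X \<and> openin X {x \<in> topspace X. p x \<in> U})"
    unfolding istopology_def
  proof (intro conjI allI impI; (elim conjE)?)
    fix S T
    assume "openin X {x \<in> topspace X. p x \<in> S}" "openin X {x \<in> topspace X. p x \<in> T}"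
    then have "openin X ({x \<in> topspace X. p x \<in> S} \<inter> {x \<in> topspace X. p x \<in> T})"
      by (rule openin_Int)
    also have "{x \<in> topspace X. p x \<in> S} \<inter> {x \<in> topspace X. p x \<in> T}
               = {x \<in> topspace X. p x \<in> S \<inter> T}" by auto
    finally show "openin X {x \<in> topspace X. p x \<in> S \<inter> T}" .
  next
    fix K
    assume *: "\<forall>U\<in>K. U \<subseteq> p ` topspace X \<and> openin X {x \<in> topspace X. p x \<in> U}"
    then have "openin X (\<Union>U\<in>K. {x \<in> topspace X. p x \<in> U})" by blast
    also have "(\<Union>U\<in>K. {x \<in> topspace X. p x \<in> U}) = {x \<in> topspace X. p x \<in> \<Union>K}" by auto
    finally show "openin X {x \<in> topspace X. p x \<in> \<Union>K}" .
  qed blast+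
  then show ?thesis
    unfolding quotient_topology_def by (simp add: topology_inverse')
qed

lemma topspace_quotient_topology [simp]: "topspace (quotient_topology X p) = p ` topspace X"
proof -
  have "{x \<in> topspace X. p x \<in> p ` topspace X} = topspace X" by blast
  then have "openin (quotient_topology X p) (p ` topspace X)"
    by (simp add: openin_quotient_topology)
  then have "p ` topspace X \<subseteq> topspace (quotient_topology X p)"
    by (rule openin_subset)
  moreover have "topspace (quotient_topology X p) \<subseteq> p ` topspace X"
    using openin_topspace[of "quotient_topology X p"] by (simp only: openin_quotient_topology)
  ultimately show ?thesis by simp
qed

lemma quotient_map_quotient_topology: "quotient_map X (quotient_topology X p) p"
  by (simp add: quotient_map_def openin_quotient_topology)

lemma connectedin_point_class: "connectedin X (point_class X x)"
proof -
  have *: "z \<in> U"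
    if "openin X U" "y \<in> U" "y \<in> point_class X x" "z \<in> point_class X x" for U y z
  proof -
    have "y \<in> X closure_of {y}"
      using that(3) unfolding point_class_def in_closure_of by blast
    moreover have "X closure_of {y} = X closure_of {z}"
      using that by (auto simp: point_class_def)
    ultimately have "y \<in> X closure_of {z}" by simp
    then show ?thesis using that(1,2) unfolding in_closure_of by blast
  qed
  have "point_class X x \<subseteq> topspace X" by (auto simp: point_class_def)
  then show ?thesis
    unfolding connectedin
  proof (intro conjI notI; (elim exE conjE)?)
    fix E1 E2
    assume E: "openin X E1" "E1 \<inter> E2 \<inter> point_class X x = {}"
      "E1 \<inter> point_class X x \<noteq> {}" "E2 \<inter> point_class X x \<noteq> {}"
    then obtain y z where "y \<in> E1" "y \<in> point_class X x" "z \<in> E2" "z \<in> point_class X x"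
      by blast
    moreover from this have "z \<in> E1" using *[OF E(1)] by simp
    ultimately show False using E(2) by blast
  qed
qed

lemma mem_abstract_element:
  assumes "x \<in> topspace X" shows "x \<in> abstract_element X x"
  using assms by (auto simp: abstract_element_def connected_component_of_refl)

lemma Union_morse_vertices: "\<Union>(morse_vertices X) = quasi_recurrent_points X"
  unfolding morse_vertices_def Union_connected_components_of
  by (auto simp: quasi_recurrent_points_def)

lemma morse_vertices_eq:
  assumes "v \<in> morse_vertices X" "w \<in> morse_vertices X" "y \<in> v" "y \<in> w"
  shows "v = w"
proof (rule ccontr)
  assume "v \<noteq> w"
  then have "disjnt v w"
    using pairwiseD[OF pairwise_disjoint_connected_components_of] assms(1,2)
    unfolding morse_vertices_def by metis
  then show False using assms(3,4) unfolding disjnt_iff by blast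
qed

lemma hyper_edge_index:
  assumes "x \<in> hyper_edge X I" "I \<subseteq> morse_vertices X"
  shows "I = {v \<in> morse_vertices X. v \<inter> (X closure_of {x} - {x}) \<noteq> {}}"
proof -
  obtain C where "\<forall>i\<in>I. invariant_set X (C i) \<and> C i \<noteq> {} \<and> C i \<subseteq> X closure_of {x} - {x} \<and> C i \<subseteq> i"
    and C2: "X closure_of {x} - {x} = (\<Union>i\<in>I. C i)"
    using assms(1) unfolding hyper_edge_def mem_Collect_eq by (elim conjE exE)
  then have C1: "C i \<noteq> {}" "C i \<subseteq> X closure_of {x} - {x}" "C i \<subseteq> i" if "i \<in> I" for i
    using that by simp_all
  show ?thesis
  proof (intro equalityI subsetI CollectI conjI)
    fix i assume i: "i \<in> I"
    show "i \<in> morse_vertices X" using i assms(2) by blast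
    show "i \<inter> (X closure_of {x} - {x}) \<noteq> {}" using C1[OF i] by blast
  next
    fix v assume "v \<in> {v \<in> morse_vertices X. v \<inter> (X closure_of {x} - {x}) \<noteq> {}}"
    then obtain y where v: "v \<in> morse_vertices X" "y \<in> v" and "y \<in> X closure_of {x} - {x}"
      by blast
    then obtain i where i: "i \<in> I" "y \<in> C i" unfolding C2 by blast
    then have "i \<in> morse_vertices X" "y \<in> i" using C1[of i] assms(2) by blast+
    then show "v \<in> I" using morse_vertices_eq[of v X i y] v i by simp
  qed
qed

lemma hyper_edge_exists:
  assumes "x \<in> topspace X" "x \<notin> quasi_recurrent_points X"
  shows "\<exists>I \<subseteq> morse_vertices X. x \<in> hyper_edge X I"
proof -
  let ?B = "X closure_of {x} - {x}"
  have "x \<notin> recurrent_points X"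
    using assms mem_abstract_element by (fastforce simp: quasi_recurrent_points_def)
  then have clB: "closedin X ?B"
    using assms(1) by (auto simp: recurrent_points_def nonproper_points_def proper_points_def)
  have cls: "point_class X y \<subseteq> ?B \<inter> quasi_recurrent_points X" if y: "y \<in> ?B" for y
  proof
    fix z assume "z \<in> point_class X y"
    then have z: "z \<in> topspace X" "X closure_of {z} = X closure_of {y}"
      by (auto simp: point_class_def)
    have sub: "X closure_of {y} \<subseteq> ?B"
      using clB y by (simp add: closure_of_minimal)
    have zin: "z \<in> X closure_of {z}" and xin: "x \<in> X closure_of {x}"
      using z(1) assms(1) by (auto simp: in_closure_of)
    have "z \<in> non_maximal_points X"
      unfolding non_maximal_points_def using z sub xin assms(1) by auto
    then have "z \<in> quasi_recurrent_points X"
      using z(1) mem_abstract_element by (fastforce simp: quasi_recurrent_points_def)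
    then show "z \<in> ?B \<inter> quasi_recurrent_points X" using sub zin z(2) by blast
  qed
  have self: "y \<in> point_class X y" if "y \<in> ?B" for y
    using that by (auto simp: point_class_def in_closure_of)
  have inV: "point_class X y \<subseteq> v" if "v \<in> morse_vertices X" "y \<in> v" "y \<in> ?B" for v y
  proof -
    have "connectedin (subtopology X (quasi_recurrent_points X)) (point_class X y)"
      using cls[OF that(3)] by (simp add: connectedin_subtopology connectedin_point_class)
    then show ?thesis
      using that self[OF that(3)] unfolding morse_vertices_def
      by (meson connected_components_of_maximal disjnt_iff)
  qed
  define I where "I = {v \<in> morse_vertices X. v \<inter> ?B \<noteq> {}}"
  have "invariant_set X (i \<inter> ?B)" if "i \<in> I" for i
    unfolding invariant_set_def
  proof (intro exI conjI)
    show "i \<inter> ?B \<subseteq> topspace X"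
      using closure_of_subset_topspace by fastforce
    show "i \<inter> ?B = (\<Union>y\<in>i \<inter> ?B. point_class X y)"
    proof (intro equalityI subsetI)
      fix y assume "y \<in> i \<inter> ?B"
      then show "y \<in> (\<Union>y\<in>i \<inter> ?B. point_class X y)" using self by blast
    next
      fix z assume "z \<in> (\<Union>y\<in>i \<inter> ?B. point_class X y)"
      then obtain y where y: "y \<in> i" "y \<in> ?B" "z \<in> point_class X y" by blast
      have "i \<in> morse_vertices X" using that unfolding I_def by blast
      then show "z \<in> i \<inter> ?B" using inV[OF _ y(1,2)] cls[OF y(2)] y(3) by blast
    qed
  qed
  moreover have "disjoint_family_on (\<lambda>i. i \<inter> ?B) I"
    unfolding disjoint_family_on_def
  proof (intro ballI impI)
    fix v w assume "v \<in> I" "w \<in> I" "v \<noteq> w"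
    then have "v \<inter> w = {}" unfolding I_def using morse_vertices_eq[of v X w] by blast
    then show "v \<inter> ?B \<inter> (w \<inter> ?B) = {}" by blast
  qed
  moreover have "?B = (\<Union>i\<in>I. i \<inter> ?B)"
  proof (intro equalityI subsetI)
    fix y assume y: "y \<in> ?B"
    then obtain v where "v \<in> morse_vertices X" "y \<in> v"
      using cls[OF y] self[OF y] Union_morse_vertices[of X] by blast
    then show "y \<in> (\<Union>i\<in>I. i \<inter> ?B)" using y unfolding I_def by blast
  qed blast
  moreover have "\<forall>i\<in>I. i \<inter> ?B \<noteq> {}" by (simp add: I_def)
  ultimately have "x \<in> hyper_edge X I"
    unfolding hyper_edge_def using assms Union_morse_vertices[of X]
    by (intro CollectI conjI exI[of _ "\<lambda>i. i \<inter> ?B"]) auto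
  moreover have "I \<subseteq> morse_vertices X" unfolding I_def by blast
  ultimately show ?thesis by blast
qed

lemma partition_on_morse_decomposition:
  "partition_on (topspace X) (morse_decomposition X)"
proof (rule partition_onI)
  have eq: "morse_decomposition X = morse_vertices X \<union> hyper_edge X ` morse_hyper_edges X"
    by (simp add: morse_decomposition_def morse_hypergraph_def)
  have Q: "quasi_recurrent_points X \<subseteq> topspace X"
    by (auto simp: quasi_recurrent_points_def)
  have H: "hyper_edge X I \<subseteq> topspace X - quasi_recurrent_points X" for I
    using Union_morse_vertices[of X] by (auto simp: hyper_edge_def)
  show "\<Union>(morse_decomposition X) = topspace X"
  proof (intro equalityI subsetI)
    fix x assume "x \<in> \<Union>(morse_decomposition X)"
    then show "x \<in> topspace X" using eq Q H Union_morse_vertices[of X] by blast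
  next
    fix x assume x: "x \<in> topspace X"
    show "x \<in> \<Union>(morse_decomposition X)"
    proof (cases "x \<in> quasi_recurrent_points X")
      case True
      then show ?thesis using eq Union_morse_vertices[of X] by blast
    next
      case False
      then show ?thesis using hyper_edge_exists[OF x] eq
        unfolding morse_hyper_edges_def by blast
    qed
  qed
  have VV: "disjnt p q" if "p \<in> morse_vertices X" "q \<in> morse_vertices X" "p \<noteq> q" for p q
    using that morse_vertices_eq[of p X q] unfolding disjnt_iff by blast
  have VH: "disjnt p (hyper_edge X I)" if "p \<in> morse_vertices X" for p I
    using that H[of I] Union_morse_vertices[of X] unfolding disjnt_def by blast
  have HH: "disjnt (hyper_edge X I) (hyper_edge X J)"
    if "I \<in> morse_hyper_edges X" "J \<in> morse_hyper_edges X" "hyper_edge X I \<noteq> hyper_edge X J" for I J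
  proof (rule ccontr)
    assume "\<not> ?thesis"
    then obtain x where x: "x \<in> hyper_edge X I" "x \<in> hyper_edge X J" by (auto simp: disjnt_def)
    have IJ: "I \<subseteq> morse_vertices X" "J \<subseteq> morse_vertices X"
      using that(1,2) by (auto simp: morse_hyper_edges_def)
    have "I = J"
      by (rule trans[OF hyper_edge_index[OF x(1) IJ(1)] sym[OF hyper_edge_index[OF x(2) IJ(2)]]])
    then show False using that(3) by simp
  qed
  show "disjnt p q" if "p \<in> morse_decomposition X" "q \<in> morse_decomposition X" "p \<noteq> q" for p q
    using that(1,2) unfolding eq
  proof (elim UnE imageE)
    show ?thesis if "p \<in> morse_vertices X" "q \<in> morse_vertices X"
      using VV[OF that \<open>p \<noteq> q\<close>] .
    show ?thesis if "p \<in> morse_vertices X" "q = hyper_edge X J" for J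
      using VH[OF that(1)] that(2) by simp
    show ?thesis if "p = hyper_edge X I" "q \<in> morse_vertices X" for I
      using VH[OF that(2)] that(1) by (simp add: disjnt_sym)
    show ?thesis if "p = hyper_edge X I" "I \<in> morse_hyper_edges X"
      "q = hyper_edge X J" "J \<in> morse_hyper_edges X" for I J
      using HH[OF that(2,4)] that(1,3) \<open>p \<noteq> q\<close> by simp
  qed
  have "{} \<notin> morse_vertices X"
    using nonempty_connected_components_of unfolding morse_vertices_def by blast
  then show "{} \<notin> morse_decomposition X"
    unfolding eq by (auto simp: morse_hyper_edges_def)
qed

lemma ex1_morse_cell:
  assumes "x \<in> topspace X"
  shows "\<exists>!D. D \<in> morse_decomposition X \<and> x \<in> D"
proof -
  note P = partition_on_morse_decomposition[of X]
  have "\<exists>D \<in> morse_decomposition X. x \<in> D"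
    using partition_onD1[OF P] assms by auto
  moreover have "D = D'"
    if "D \<in> morse_decomposition X \<and> x \<in> D" "D' \<in> morse_decomposition X \<and> x \<in> D'" for D D'
    using disjointD[OF partition_onD2[OF P], of D D'] that by auto
  ultimately show ?thesis by (meson ex1I)
qed

lemma morse_cell:
  assumes "x \<in> topspace X"
  shows "morse_cell X x \<in> morse_decomposition X" "x \<in> morse_cell X x"
  unfolding morse_cell_def using theI'[OF ex1_morse_cell[OF assms]] by blast+

lemma topspace_morse_hypergraph_space:
  "topspace (morse_hypergraph_space X) = morse_decomposition X"
proof -
  note P = partition_on_morse_decomposition[of X]
  have "D \<in> morse_cell X ` topspace X" if D: "D \<in> morse_decomposition X" for D
  proof -
    obtain x where x: "x \<in> D"
      using D partition_onD3[OF P] by (metis ex_in_conv)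
    then have xt: "x \<in> topspace X"
      using D partition_onD1[OF P] by blast
    have "D = morse_cell X x"
      using ex1_morse_cell[OF xt] D x morse_cell[OF xt] by blast
    then show ?thesis using xt by (rule image_eqI)
  qed
  moreover have "morse_cell X ` topspace X \<subseteq> morse_decomposition X"
    by (intro image_subsetI morse_cell(1))
  ultimately show ?thesis
    unfolding morse_hypergraph_space_def topspace_quotient_topology by (intro equalityI subsetI) auto
qed

end

theory Submission
  imports Defs
begin

text \<open>
  Everything reduces to \<open>abstract_element_subset_morse_cell\<close>: a cell of the Morse
  decomposition that contains a point \<open>x\<close> contains its whole abstract element. Given this,
  the map sending a point to its cell is constant on abstract elements, so it factors through
  the abstract element space, and the factor is a quotient map because the composite is one.

  For the containment, abstract elements partition the space
  (\<open>abstract_element_eq_of_mem\<close>), so being quasi-recurrent, which is a property of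
  \<open>\<langle>x\<rangle>\<close>, is shared by all points of \<open>\<langle>x\<rangle>\<close>. If it holds, then
  \<open>\<langle>x\<rangle>\<close> is a connected subset of the quasi-recurrent set and lies in one component,
  that is, in one vertex. If it fails, then \<open>x\<close> is not recurrent and hence is proper, so
  all points \<open>y\<close> of \<open>\<langle>x\<rangle>\<close> have the same boundary
  \<open>X closure_of {y} - {y}\<close>, and for points that are not quasi-recurrent, membership in
  a hyper-edge depends on this boundary alone.
\<close>

lemma mem_component_of_subtopology:
  assumes "y \<in> connected_component_of_set (subtopology X S) x"
  shows "x \<in> topspace X \<inter> S" "y \<in> topspace X \<inter> S"
    "connected_component_of (subtopology X S) y = connected_component_of (subtopology X S) x"
  using assms connected_component_of_equiv[of "subtopology X S" x y] by simp_all

lemma closed_points_subset_proper_points: "closed_points X \<subseteq> proper_points X"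
  by (auto simp: closed_points_def proper_points_def closure_of_closedin)

lemma abstract_element_alt:
  "abstract_element X x =
    (if x \<in> proper_points X
     then connected_component_of_set
            (subtopology X {y \<in> topspace X. X closure_of {x} - {x} = X closure_of {y} - {y}}) x
     else connected_component_of_set
            (subtopology X {y \<in> topspace X. X closure_of {x} = X closure_of {y}}) x)"
proof -
  have "closed_points X \<union> nonclosed_proper_points X = proper_points X"
    using closed_points_subset_proper_points[of X] by (auto simp: nonclosed_proper_points_def)
  then show ?thesis
    by (simp add: abstract_element_def)
qed

lemma abstract_element_subset_topspace: "abstract_element X x \<subseteq> topspace X"
proof
  fix y assume "y \<in> abstract_element X x"
  then show "y \<in> topspace X"
    unfolding abstract_element_alt
    by (cases "x \<in> proper_points X")
      (simp_all only: if_True if_False, (drule mem_component_of_subtopology(2), blast)+)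
qed

lemma connectedin_abstract_element: "connectedin X (abstract_element X x)"
proof -
  have "connectedin X (connected_component_of_set (subtopology X S) x)" for S
    using connectedin_connected_component_of[of "subtopology X S" x]
    by (simp add: connectedin_subtopology)
  then show ?thesis
    by (simp add: abstract_element_alt)
qed

lemma boundary_eq_of_mem_abstract_element:
  assumes "x \<in> proper_points X" "y \<in> abstract_element X x"
  shows "X closure_of {y} - {y} = X closure_of {x} - {x}"
proof -
  have "y \<in> connected_component_of_set
      (subtopology X {y \<in> topspace X. X closure_of {x} - {x} = X closure_of {y} - {y}}) x"
    using assms by (simp add: abstract_element_alt)
  from mem_component_of_subtopology(2)[OF this] show ?thesis
    by blast
qed

text \<open>
  If \<open>y\<close> were different from \<open>x\<close>, it would lie in the closed set
  \<open>X closure_of {x} - {x}\<close>, and then so would its closure, which contains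
  \<open>x\<close>.
\<close>

lemma proper_point_eq_of_closure_eq:
  assumes "x \<in> proper_points X" "y \<in> topspace X" "X closure_of {x} = X closure_of {y}"
  shows "x = y"
proof (rule ccontr)
  assume "x \<noteq> y"
  have x: "x \<in> topspace X" and cl: "closedin X (X closure_of {x} - {x})"
    using assms(1) by (auto simp: proper_points_def)
  have mem: "z \<in> X closure_of {z}" if "z \<in> topspace X" for z
    using that by (auto simp: in_closure_of)
  have "y \<in> X closure_of {x} - {x}"
    using mem[OF assms(2)] assms(3) \<open>x \<noteq> y\<close> by auto
  then have "X closure_of {y} \<subseteq> X closure_of {x} - {x}"
    using cl by (simp add: closure_of_minimal)
  then show False
    using mem[OF x] assms(3) by blast
qed

text \<open>
  The two clauses defining an abstract element do not mix: a point with the same boundary as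
  a proper point is proper, as properness is closedness of the boundary, and a point with the
  same closure as a non-proper point is not proper, by the previous lemma. Hence \<open>x\<close> and
  \<open>y\<close> determine the same subspace, of which \<open>\<langle>x\<rangle>\<close> and
  \<open>\<langle>y\<rangle>\<close> are connected components with a common point.
\<close>

lemma abstract_element_eq_of_mem:
  assumes "y \<in> abstract_element X x"
  shows "abstract_element X y = abstract_element X x"
proof (cases "x \<in> proper_points X")
  case True
  let ?S = "{z \<in> topspace X. X closure_of {x} - {x} = X closure_of {z} - {z}}"
  have "y \<in> connected_component_of_set (subtopology X ?S) x"
    using assms True by (simp only: abstract_element_alt if_True)
  note y = mem_component_of_subtopology(2,3)[OF this]
  have bd: "X closure_of {y} - {y} = X closure_of {x} - {x}"
    using y(1) by blast
  have "y \<in> proper_points X"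
    using True y(1) bd by (simp add: proper_points_def)
  then have "abstract_element X y = connected_component_of_set (subtopology X ?S) y"
    by (simp only: abstract_element_alt if_True bd)
  also have "\<dots> = abstract_element X x"
    using True by (simp only: abstract_element_alt if_True y(2))
  finally show ?thesis .
next
  case False
  let ?S = "{z \<in> topspace X. X closure_of {x} = X closure_of {z}}"
  have "y \<in> connected_component_of_set (subtopology X ?S) x"
    using assms False by (simp only: abstract_element_alt if_False)
  note y = mem_component_of_subtopology[OF this]
  have x: "x \<in> topspace X" and cl: "X closure_of {y} = X closure_of {x}"
    using y(1,2) by blast+
  have "y \<notin> proper_points X"
    using proper_point_eq_of_closure_eq[OF _ x cl] False by blast
  then have "abstract_element X y = connected_component_of_set (subtopology X ?S) y"
    by (simp only: abstract_element_alt if_False cl)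
  also have "\<dots> = abstract_element X x"
    using False by (simp only: abstract_element_alt if_False y(3))
  finally show ?thesis .
qed

lemma quasi_recurrent_points_iff_of_mem_abstract_element:
  assumes "x \<in> topspace X" "y \<in> abstract_element X x"
  shows "y \<in> quasi_recurrent_points X \<longleftrightarrow> x \<in> quasi_recurrent_points X"
proof -
  have "y \<in> topspace X"
    using assms(2) abstract_element_subset_topspace[of X x] by blast
  then show ?thesis
    using assms(1)
    by (simp only: quasi_recurrent_points_def mem_Collect_eq abstract_element_eq_of_mem[OF assms(2)])
qed

lemma abstract_element_subset_vertex:
  assumes "x \<in> topspace X" "v \<in> morse_vertices X" "x \<in> v"
  shows "abstract_element X x \<subseteq> v"
proof -
  have "x \<in> quasi_recurrent_points X"
    using assms(2,3) Union_morse_vertices[of X] by blast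
  then have "abstract_element X x \<subseteq> quasi_recurrent_points X"
    using quasi_recurrent_points_iff_of_mem_abstract_element[OF assms(1)] by blast
  then have "connectedin (subtopology X (quasi_recurrent_points X)) (abstract_element X x)"
    by (simp add: connectedin_subtopology connectedin_abstract_element)
  moreover have "v \<in> connected_components_of (subtopology X (quasi_recurrent_points X))"
    using assms(2) by (simp only: morse_vertices_def)
  moreover have "\<not> disjnt v (abstract_element X x)"
    using assms(3) mem_abstract_element[OF assms(1)] by (auto simp: disjnt_iff)
  ultimately show ?thesis
    using connected_components_of_maximal by blast
qed

lemma abstract_element_subset_hyper_edge:
  assumes "x \<in> hyper_edge X I"
  shows "abstract_element X x \<subseteq> hyper_edge X I"
proof
  fix y assume y: "y \<in> abstract_element X x"
  have x: "x \<in> topspace X" "x \<notin> quasi_recurrent_points X"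
    using assms Union_morse_vertices[of X] by (auto simp: hyper_edge_def)
  then have "x \<notin> recurrent_points X"
    using mem_abstract_element by (fastforce simp: quasi_recurrent_points_def)
  then have "x \<in> proper_points X"
    using x by (auto simp: recurrent_points_def nonproper_points_def)
  then have "X closure_of {y} - {y} = X closure_of {x} - {x}"
    using y by (rule boundary_eq_of_mem_abstract_element)
  moreover have "y \<in> topspace X - \<Union> (morse_vertices X)"
    using x y quasi_recurrent_points_iff_of_mem_abstract_element[OF x(1) y]
      abstract_element_subset_topspace[of X x] Union_morse_vertices[of X] by blast
  ultimately show "y \<in> hyper_edge X I"
    using assms by (simp add: hyper_edge_def)
qed

lemma abstract_element_subset_morse_cell:
  assumes "x \<in> topspace X"
  shows "abstract_element X x \<subseteq> morse_cell X x"
proof -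
  consider "morse_cell X x \<in> morse_vertices X" | I where "morse_cell X x = hyper_edge X I"
    using morse_cell(1)[OF assms] by (auto simp: morse_decomposition_def morse_hypergraph_def)
  then show ?thesis
  proof cases
    case 1
    then show ?thesis
      using abstract_element_subset_vertex[OF assms] morse_cell(2)[OF assms] by blast
  next
    case (2 I)
    then show ?thesis
      using abstract_element_subset_hyper_edge[of x X I] morse_cell(2)[OF assms] by simp
  qed
qed

lemma morse_cell_unique:
  assumes "x \<in> topspace X" "D \<in> morse_decomposition X \<and> x \<in> D"
  shows "morse_cell X x = D"
  unfolding morse_cell_def using ex1_morse_cell[OF assms(1)] assms(2) by (rule the1_equality)

lemma morse_cell_eq_of_abstract_element_eq:
  assumes "x \<in> topspace X" "y \<in> topspace X" "abstract_element X x = abstract_element X y"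
  shows "morse_cell X x = morse_cell X y"
proof -
  have "y \<in> morse_cell X x"
    using mem_abstract_element[OF assms(2)] abstract_element_subset_morse_cell[OF assms(1)]
      assms(3) by blast
  then show ?thesis
    using morse_cell(1)[OF assms(1)]
    by (intro morse_cell_unique[OF assms(2), symmetric]) simp
qed

theorem theorem4p1:
  fixes X :: "'a topology"
  shows "(\<forall>E \<in> abstract_element X ` topspace X. \<exists>!D. D \<in> morse_decomposition X \<and> E \<subseteq> D) \<and>
         (\<exists>f. quotient_map (abstract_element_space X) (morse_hypergraph_space X) f \<and>
              (\<forall>x \<in> topspace X. f (abstract_element X x) = morse_cell X x))"
proof
  show "\<forall>E \<in> abstract_element X ` topspace X. \<exists>!D. D \<in> morse_decomposition X \<and> E \<subseteq> D"
  proof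
    fix E assume "E \<in> abstract_element X ` topspace X"
    then obtain x where x: "x \<in> topspace X" and E: "E = abstract_element X x"
      by blast
    show "\<exists>!D. D \<in> morse_decomposition X \<and> E \<subseteq> D"
    proof (rule ex1I[of _ "morse_cell X x"])
      show "morse_cell X x \<in> morse_decomposition X \<and> E \<subseteq> morse_cell X x"
        using morse_cell(1)[OF x] abstract_element_subset_morse_cell[OF x] E by simp
    next
      fix D assume "D \<in> morse_decomposition X \<and> E \<subseteq> D"
      then have "D \<in> morse_decomposition X \<and> x \<in> D"
        using mem_abstract_element[OF x] E by blast
      then show "D = morse_cell X x"
        by (rule morse_cell_unique[OF x, symmetric])
    qed
  qed
next
  have p: "quotient_map X (abstract_element_space X) (abstract_element X)"
    unfolding abstract_element_space_def by (rule quotient_map_quotient_topology)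
  have q: "quotient_map X (morse_hypergraph_space X) (morse_cell X)"
    unfolding morse_hypergraph_space_def by (rule quotient_map_quotient_topology)
  obtain f where f: "continuous_map (abstract_element_space X) (morse_hypergraph_space X) f"
    and fp: "\<And>x. x \<in> topspace X \<Longrightarrow> f (abstract_element X x) = morse_cell X x"
  proof (rule quotient_map_lift_exists[OF p quotient_imp_continuous_map[OF q]])
    show "morse_cell X x = morse_cell X y"
      if "x \<in> topspace X" "y \<in> topspace X" "abstract_element X x = abstract_element X y" for x y
      using that by (rule morse_cell_eq_of_abstract_element_eq)
  qed (rule that)
  have "quotient_map X (morse_hypergraph_space X) (f \<circ> abstract_element X)"
    using q by (rule quotient_map_eq) (simp add: fp)
  then have "quotient_map (abstract_element_space X) (morse_hypergraph_space X) f"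
    using quotient_map_from_composition[OF quotient_imp_continuous_map[OF p] f] by blast
  then show "\<exists>f. quotient_map (abstract_element_space X) (morse_hypergraph_space X) f \<and>
              (\<forall>x \<in> topspace X. f (abstract_element X x) = morse_cell X x)"
    using fp by blast
qed

end
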